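(* Let $c\in\mathbb R$, $T>0$, $\gamma>1$, and let $q_{0,\gamma}^{\mathrm{deter}}(\mathbf x_0|c)$ be the law of $\mathbf x_0$ obtained by solving the guided probability-flow ODE of the toy model described in the context from time $T$ down to time $0$, starting from $\mathbf x_T\sim q_T(\mathbf x_T|c)=\mathcal N(c,1+T)$. Then $$q_{0,\gamma}^{\mathrm{deter}}(\mathbf x_0|c)=\mathcal N\big(c\,\phi(\gamma,T),\ 2^{1-\gamma}\psi(\gamma,T)\big),$$ where $$\phi(\gamma,T)=\frac{2^{\frac{1-\gamma}{2}}}{(T+1)^{\frac{\gamma}{2}}(T+2)^{\frac{1-\gamma}{2}}}+\frac{\gamma}{2^{\frac{\gamma+1}{2}}}\int_0^T\frac{(s+1)^{-\frac{\gamma+2}{2}}}{(s+2)^{\frac{1-\gamma}{2}}}\,\mathrm ds,\qquad \psi(\gamma,T)=\frac{T+1}{(T+1)^{\gamma}(T+2)^{1-\gamma}}.$$ Moreover, with $\phi(\gamma)=\lim_{T\to+\infty}\phi(\gamma,T)$ (for $\gamma\geqslant1$), one has $$\phi(\gamma)\geqslant\gamma\,\frac{7}{15}\Big(\frac{10}{7}\Big)^{\frac{5-\gamma}{2}}\ \text{ for all }\gamma\in[1,3],\qquad \phi(1)=1,\qquad \phi(3)=2,\qquad \phi(\gamma)\geqslant2\ \text{ for all }\gamma>3,$$ and, in the limit $T\to+\infty$, $q_{0,\gamma}^{\mathrm{deter}}(\mathbf x_0|c)$ becomes $\mathcal N(c\,\phi(\gamma),2^{1-\gamma})$ (i.e.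 its mean and variance converge to $c\,\phi(\gamma)$ and $2^{1-\gamma}$).
   Context: $\mathcal N(m,v)$ denotes the one-dimensional Gaussian law with mean $m$ and variance $v$. Toy model (1-dimensional, variance-exploding diffusion with drift $f_t=0$ and diffusion coefficient $g_t=1$): $q_0(\mathbf x_0|c)=\mathcal N(c,1)$, $q(c)=\mathcal N(0,1)$, $q_0(\mathbf x_0)=\mathcal N(0,2)$, so that for $t\in[0,T]$ $$q_t(\mathbf x_t|c)=\mathcal N(c,1+t),\quad \nabla_{\mathbf x_t}\log q_t(\mathbf x_t|c)=-\frac{\mathbf x_t-c}{1+t},\qquad q_t(\mathbf x_t)=\mathcal N(0,2+t),\quad \nabla_{\mathbf x_t}\log q_t(\mathbf x_t)=-\frac{\mathbf x_t}{2+t}.$$ The classifier-free-guided score is $s_{t,\gamma}(\mathbf x,c)=\gamma\nabla_{\mathbf x}\log q_t(\mathbf x|c)+(1-\gamma)\nabla_{\mathbf x}\log q_t(\mathbf x)$, and the guided probability-flow ODE is $$\frac{\mathrm d\mathbf x_t}{\mathrm dt}=-\frac12\,s_{t,\gamma}(\mathbf x_t,c),\qquad t\in[0,T].$$ *)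

theory Defs
  imports "HOL-Probability.Probability"
begin

text \<open>
  The library's \<^term>\<open>normal_density\<close> is parametrised by the standard deviation;
  here Gaussian laws are parametrised by their variance.
\<close>

definition gaussian :: "real \<Rightarrow> real \<Rightarrow> real measure" where
  "gaussian m v = density lborel (\<lambda>x. ennreal (normal_density m (sqrt v) x))"

definition cond_density :: "real \<Rightarrow> real \<Rightarrow> real \<Rightarrow> real" where
  "cond_density t c x = normal_density c (sqrt (1 + t)) x"

definition marg_density :: "real \<Rightarrow> real \<Rightarrow> real" where
  "marg_density t x = normal_density 0 (sqrt (2 + t)) x"

definition score :: "(real \<Rightarrow> real) \<Rightarrow> real \<Rightarrow> real" where
  "score q x = deriv (\<lambda>y. ln (q y)) x"

definition guided_score :: "real \<Rightarrow> real \<Rightarrow> real \<Rightarrow> real \<Rightarrow> real" where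
  "guided_score \<gamma> t x c =
     \<gamma> * score (cond_density t c) x + (1 - \<gamma>) * score (marg_density t) x"

definition solves_guided_ode :: "real \<Rightarrow> real \<Rightarrow> real \<Rightarrow> (real \<Rightarrow> real) \<Rightarrow> bool" where
  "solves_guided_ode \<gamma> c T x \<longleftrightarrow>
     (\<forall>t\<in>{0..T}. (x has_real_derivative (- (1/2) * guided_score \<gamma> t (x t) c)) (at t within {0..T}))"

text \<open>
  The equation is linear in the state with coefficients continuous on \<open>[0, T]\<close>, so every
  terminal value at time \<open>T\<close> belongs to exactly one solution and the description below is proper.
\<close>

definition backward_flow :: "real \<Rightarrow> real \<Rightarrow> real \<Rightarrow> real \<Rightarrow> real" where
  "backward_flow \<gamma> c T y = (THE z. \<exists>x. solves_guided_ode \<gamma> c T x \<and> x T = y \<and> x 0 = z)"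

definition q0_deter :: "real \<Rightarrow> real \<Rightarrow> real \<Rightarrow> real measure" where
  "q0_deter \<gamma> c T = distr (density lborel (\<lambda>x. ennreal (cond_density T c x))) borel (backward_flow \<gamma> c T)"

definition phi :: "real \<Rightarrow> real \<Rightarrow> real" where
  "phi \<gamma> T =
     2 powr ((1 - \<gamma>) / 2) / ((T + 1) powr (\<gamma> / 2) * (T + 2) powr ((1 - \<gamma>) / 2))
     + \<gamma> / 2 powr ((\<gamma> + 1) / 2)
       * integral {0..T} (\<lambda>s. (s + 1) powr (- ((\<gamma> + 2) / 2)) / (s + 2) powr ((1 - \<gamma>) / 2))"

definition psi :: "real \<Rightarrow> real \<Rightarrow> real" where
  "psi \<gamma> T = (T + 1) / ((T + 1) powr \<gamma> * (T + 2) powr (1 - \<gamma>))"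

definition phi_lim :: "real \<Rightarrow> real" where
  "phi_lim \<gamma> = Lim at_top (phi \<gamma>)"

text \<open>
  Consistency of the model: the conditional densities arise from \<open>N(c, 1)\<close> by adding independent
  noise of variance \<open>t\<close>, the marginal ones by averaging over \<open>c\<close> with law \<open>N(0, 1)\<close>, and the
  scores have the expected closed forms.
\<close>

lemma normal_density_shift: "normal_density m s x = normal_density 0 s (x - m)"
  by (simp add: normal_density_def)

lemma cond_density_eq_conv:
  assumes "t > 0"
  shows "(\<integral>\<^sup>+y. ennreal (normal_density 0 (sqrt t) (x - y) * cond_density 0 c y) \<partial>lborel)
           = ennreal (cond_density t c x)"
proof -
  have "(\<integral>\<^sup>+y. ennreal (normal_density 0 (sqrt t) (x - y) * cond_density 0 c y) \<partial>lborel)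
      = (\<integral>\<^sup>+y. ennreal (normal_density 0 (sqrt t) ((x - c) - y) * normal_density 0 1 y) \<partial>lborel)"
    by (subst nn_integral_real_affine[where c = 1 and t = c])
       (auto simp: cond_density_def normal_density_shift[of c] algebra_simps)
  also have "\<dots> = ennreal (normal_density 0 (sqrt ((sqrt t)\<^sup>2 + 1\<^sup>2)) (x - c))"
    using conv_normal_density_zero_mean[of "sqrt t" 1] assms by (simp add: fun_eq_iff)
  finally show ?thesis
    using assms by (simp add: cond_density_def normal_density_shift[of c] add.commute)
qed

lemma marg_density_eq_mixture:
  assumes "t \<ge> 0"
  shows "(\<integral>\<^sup>+c. ennreal (cond_density t c x * normal_density 0 1 c) \<partial>lborel)
           = ennreal (marg_density t x)"
proof -
  have "(\<integral>\<^sup>+c. ennreal (cond_density t c x * normal_density 0 1 c) \<partial>lborel)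
      = (\<integral>\<^sup>+c. ennreal (normal_density 0 (sqrt (1 + t)) (x - c) * normal_density 0 1 c) \<partial>lborel)"
    unfolding cond_density_def by (subst normal_density_shift) simp
  also have "\<dots> = ennreal (normal_density 0 (sqrt ((sqrt (1 + t))\<^sup>2 + 1\<^sup>2)) x)"
    using conv_normal_density_zero_mean[of "sqrt (1 + t)" 1] assms by (simp add: fun_eq_iff)
  finally show ?thesis
    using assms by (simp add: marg_density_def add.commute)
qed

lemma score_normal_density:
  assumes "v > 0"
  shows "score (normal_density m (sqrt v)) x = - (x - m) / v"
proof -
  have "(\<lambda>y. ln (normal_density m (sqrt v) y)) = (\<lambda>y. - ln (sqrt (2 * pi * v)) - (y - m)\<^sup>2 / (2 * v))"
    using assms by (auto simp: fun_eq_iff normal_density_def ln_mult ln_div)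
  moreover have "((\<lambda>y. - ln (sqrt (2 * pi * v)) - (y - m)\<^sup>2 / (2 * v)) has_real_derivative - (x - m) / v) (at x)"
    using assms by (auto intro!: derivative_eq_intros simp: field_simps)
  ultimately show ?thesis
    by (simp add: score_def DERIV_imp_deriv)
qed

lemma score_cond_density: "t \<ge> 0 \<Longrightarrow> score (cond_density t c) x = - (x - c) / (1 + t)"
  using score_normal_density[of "1 + t" c x] by (simp add: cond_density_def[abs_def])

lemma score_marg_density: "t \<ge> 0 \<Longrightarrow> score (marg_density t) x = - x / (2 + t)"
  using score_normal_density[of "2 + t" 0 x] by (simp add: marg_density_def[abs_def])

end

theory Submission
  imports Defs "HOL-Real_Asymp.Real_Asymp"
begin

text \<open>
  The guided equation is linear with integrating factor \<open>P t = (t + 1) powr (\<gamma> / 2) * (t + 2) powr ((1 - \<gamma>) / 2)\<close>,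
  so the backward flow is affine and maps a Gaussian law to a Gaussian law. The substitution
  \<open>w = 1 / sqrt (s + 1)\<close> turns the integral in \<open>phi\<close> into a proper one, and as \<open>T\<close> grows
  \<open>phi \<gamma> T\<close> tends to \<open>\<gamma> * F ((\<gamma> - 1) / 2)\<close>, where \<open>F a\<close> is the integral of \<open>((1 + w\<^sup>2) / 2) powr a\<close>
  over \<open>[0, 1]\<close>. The bound on \<open>[1, 3]\<close> is Jensen's inequality for the mean of \<open>(1 + w\<^sup>2) / 2\<close>; the bound
  for \<open>\<gamma> > 3\<close> follows from the recursion \<open>(2 * a + 1) * F a = 1 + a * F (a - 1)\<close> and
  \<open>w \<le> (1 + w\<^sup>2) / 2\<close>.
\<close>

subsection \<open>The guided flow\<close>

definition integrating_factor :: "real \<Rightarrow> real \<Rightarrow> real" where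
  "integrating_factor \<gamma> t = (t + 1) powr (\<gamma> / 2) * (t + 2) powr ((1 - \<gamma>) / 2)"

text \<open>The integrand of \<open>phi\<close> in the same syntactic form, so that
  \<open>phi_eq\<close> can fold it.\<close>

definition forcing :: "real \<Rightarrow> real \<Rightarrow> real" where
  "forcing \<gamma> s = (s + 1) powr (- ((\<gamma> + 2) / 2)) / (s + 2) powr ((1 - \<gamma>) / 2)"

lemma integrating_factor_pos: "t \<ge> 0 \<Longrightarrow> integrating_factor \<gamma> t > 0"
  by (simp add: integrating_factor_def)

lemma integrating_factor_0: "integrating_factor \<gamma> 0 = 2 powr ((1 - \<gamma>) / 2)"
  by (simp add: integrating_factor_def)

lemma forcing_eq:
  assumes "s \<ge> 0"
  shows "forcing \<gamma> s = 1 / ((s + 1) * integrating_factor \<gamma> s)"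
proof -
  have e: "- ((\<gamma> + 2) / 2) = - (1 + \<gamma> / 2)"
    by (simp add: field_simps)
  have "(s + 1) powr (- ((\<gamma> + 2) / 2)) = 1 / ((s + 1) * (s + 1) powr (\<gamma> / 2))"
    unfolding e powr_minus_divide powr_add using assms by simp
  then show ?thesis
    by (simp add: forcing_def integrating_factor_def)
qed

lemma continuous_on_forcing: "continuous_on {0..T} (forcing \<gamma>)"
  unfolding forcing_def[abs_def] by (intro continuous_intros) auto

text \<open>Both powers of 2 reduce to \<open>integrating_factor \<gamma> 0\<close>. In this form
  \<open>c * phi \<gamma> T\<close> is the image of the mean \<open>c\<close> under the affine map
  of \<open>backward_flow_eq\<close>.\<close>

lemma phi_eq:
  "phi \<gamma> T = integrating_factor \<gamma> 0 / integrating_factor \<gamma> T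
     + \<gamma> / 2 * integrating_factor \<gamma> 0 * integral {0..T} (forcing \<gamma>)"
proof -
  have "(2::real) powr ((\<gamma> + 1) / 2) = 2 powr (1 - (1 - \<gamma>) / 2)"
    by (simp add: field_simps)
  then have e: "\<gamma> / 2 powr ((\<gamma> + 1) / 2) = \<gamma> / 2 * 2 powr ((1 - \<gamma>) / 2)"
    by (simp add: powr_diff)
  show ?thesis
    by (simp only: phi_def e integrating_factor_0 integrating_factor_def[of \<gamma> T] forcing_def[abs_def])
qed

lemma has_real_derivative_integrating_factor:
  assumes "t \<ge> 0"
  shows "(integrating_factor \<gamma> has_real_derivative
           integrating_factor \<gamma> t * (\<gamma> / (2 * (t + 1)) + (1 - \<gamma>) / (2 * (t + 2)))) (at t within S)"
proof -
  have p: "y powr (a - 1) = y powr a / y" if "y > 0" for y a :: real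
    using that by (simp add: powr_diff)
  show ?thesis
    unfolding integrating_factor_def[abs_def]
    using assms
    by (auto intro!: derivative_eq_intros simp: p algebra_simps)
qed

lemma guided_ode_rhs:
  assumes "t \<ge> 0"
  shows "- (1/2) * guided_score \<gamma> t y c
           = (\<gamma> / (2 * (t + 1)) + (1 - \<gamma>) / (2 * (t + 2))) * y - \<gamma> * c / (2 * (t + 1))"
proof -
  have "- (1/2) * (\<gamma> * (- (y - c) / d) + (1 - \<gamma>) * (- y / e))
      = (\<gamma> / (2 * d) + (1 - \<gamma>) / (2 * e)) * y - \<gamma> * c / (2 * d)"
    if "d \<noteq> 0" "e \<noteq> 0" for d e
    using that by (simp add: field_simps)
  from this[of "t + 1" "t + 2"] show ?thesis
    using assms by (simp add: guided_score_def score_cond_density score_marg_density add.commute)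
qed

text \<open>Variation of constants: along a solution, \<open>x / P\<close> has derivative
  \<open>- \<gamma> * c / 2 * forcing \<gamma>\<close>, so \<open>I\<close> is constant; compare its
  values at \<open>0\<close> and \<open>T\<close>. This gives uniqueness in
  \<open>backward_flow\<close>.\<close>

lemma guided_ode_first_integral:
  assumes x: "solves_guided_ode \<gamma> c T x" and "T \<ge> 0"
  shows "x 0 = integrating_factor \<gamma> 0 / integrating_factor \<gamma> T * x T
           + c * (\<gamma> / 2 * integrating_factor \<gamma> 0 * integral {0..T} (forcing \<gamma>))"
proof -
  let ?P = "integrating_factor \<gamma>"
  define I where "I = (\<lambda>t. x t / ?P t + \<gamma> * c / 2 * integral {0..t} (forcing \<gamma>))"
  have "(I has_real_derivative 0) (at t within {0..T})" if t: "t \<in> {0..T}" for t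
  proof -
    define p where "p = ?P t"
    define k where "k = \<gamma> / (2 * (t + 1)) + (1 - \<gamma>) / (2 * (t + 2))"
    have t0: "t \<ge> 0"
      using t by simp
    have p0: "p > 0"
      using integrating_factor_pos[OF t0] unfolding p_def .
    have dx: "(x has_real_derivative k * x t - \<gamma> * c / (2 * (t + 1))) (at t within {0..T})"
      using bspec[OF x[unfolded solves_guided_ode_def] t] by (simp only: guided_ode_rhs[OF t0, of \<gamma>, folded k_def])
    have dP: "(?P has_real_derivative p * k) (at t within {0..T})"
      using has_real_derivative_integrating_factor[of t \<gamma>] t by (simp add: k_def p_def)
    have dJ: "((\<lambda>t. integral {0..t} (forcing \<gamma>)) has_real_derivative 1 / ((t + 1) * p)) (at t within {0..T})"
      using integral_has_real_derivative[OF continuous_on_forcing t, of \<gamma>] t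
      by (simp add: forcing_eq p_def)
    have "((\<lambda>t. x t / ?P t) has_real_derivative
            ((k * x t - \<gamma> * c / (2 * (t + 1))) * ?P t - x t * (p * k)) / (?P t * ?P t)) (at t within {0..T})"
      by (rule DERIV_divide[OF dx dP]) (use p0 p_def in simp)
    note DERIV_add[OF this DERIV_cmult[OF dJ, of "\<gamma> * c / 2"]]
    moreover have "((k * y - b / (2 * d)) * q - y * (q * k)) / (q * q) + b / 2 * (1 / (d * q)) = 0"
      if "q > 0" "d > 0" for y b d q
      using that by (simp add: field_simps)
    from this[of p "t + 1" "x t" "\<gamma> * c"] have
      "((k * x t - \<gamma> * c / (2 * (t + 1))) * ?P t - x t * (p * k)) / (?P t * ?P t)
         + \<gamma> * c / 2 * (1 / ((t + 1) * p)) = 0"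
      using p0 t0 by (simp flip: p_def)
    ultimately show ?thesis
      unfolding I_def by (rule DERIV_cong)
  qed
  then obtain C where C: "\<And>t. t \<in> {0..T} \<Longrightarrow> I t = C"
    using has_field_derivative_zero_constant[of "{0..T}" I] by auto
  have "I 0 = I T"
    using C[of 0] C[of T] \<open>T \<ge> 0\<close> by simp
  then show ?thesis
    using integrating_factor_pos[of 0 \<gamma>] by (simp add: I_def field_simps)
qed

lemma guided_ode_solution_exists:
  assumes "T \<ge> 0"
  shows "\<exists>x. solves_guided_ode \<gamma> c T x \<and> x T = y"
proof -
  let ?P = "integrating_factor \<gamma>"
  \<comment> \<open>\<open>D\<close> is the value of the first integral forced by the terminal
    condition \<open>x T = y\<close>.\<close>
  define D where "D = y / ?P T + \<gamma> * c / 2 * integral {0..T} (forcing \<gamma>)"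
  define x where "x = (\<lambda>t. ?P t * (D - \<gamma> * c / 2 * integral {0..t} (forcing \<gamma>)))"
  have "(x has_real_derivative - (1/2) * guided_score \<gamma> t (x t) c) (at t within {0..T})"
    if t: "t \<in> {0..T}" for t
  proof -
    define p where "p = ?P t"
    define k where "k = \<gamma> / (2 * (t + 1)) + (1 - \<gamma>) / (2 * (t + 2))"
    define j where "j = D - \<gamma> * c / 2 * integral {0..t} (forcing \<gamma>)"
    have t0: "t \<ge> 0"
      using t by simp
    have p0: "p > 0"
      using integrating_factor_pos[OF t0] unfolding p_def .
    have dP: "(?P has_real_derivative p * k) (at t within {0..T})"
      using has_real_derivative_integrating_factor[of t \<gamma>] t by (simp add: k_def p_def)
    have dJ: "((\<lambda>t. integral {0..t} (forcing \<gamma>)) has_real_derivative 1 / ((t + 1) * p)) (at t within {0..T})"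
      using integral_has_real_derivative[OF continuous_on_forcing t, of \<gamma>] t
      by (simp add: forcing_eq p_def)
    have "(x has_real_derivative p * k * j + (0 - \<gamma> * c / 2 * (1 / ((t + 1) * p))) * p) (at t within {0..T})"
      unfolding x_def j_def p_def
      by (intro DERIV_mult DERIV_diff DERIV_const DERIV_cmult dP[unfolded p_def] dJ[unfolded p_def])
    moreover have "p * k * j + (0 - \<gamma> * c / 2 * (1 / ((t + 1) * p))) * p
        = - (1/2) * guided_score \<gamma> t (x t) c"
      unfolding guided_ode_rhs[OF t0, of \<gamma>, folded k_def]
      using t0 p0 by (simp add: x_def j_def flip: p_def)
    ultimately show ?thesis
      by simp
  qed
  moreover have "x T = y"
    using integrating_factor_pos[OF assms, of \<gamma>] by (simp add: x_def D_def)
  ultimately show ?thesis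
    unfolding solves_guided_ode_def by blast
qed

lemma backward_flow_eq:
  assumes "T \<ge> 0"
  shows "backward_flow \<gamma> c T y = integrating_factor \<gamma> 0 / integrating_factor \<gamma> T * y
           + c * (\<gamma> / 2 * integrating_factor \<gamma> 0 * integral {0..T} (forcing \<gamma>))"
  unfolding backward_flow_def
proof (rule the_equality)
  obtain x where x: "solves_guided_ode \<gamma> c T x" "x T = y"
    using guided_ode_solution_exists[OF assms] by blast
  then show "\<exists>x. solves_guided_ode \<gamma> c T x \<and> x T = y \<and>
      x 0 = integrating_factor \<gamma> 0 / integrating_factor \<gamma> T * y
            + c * (\<gamma> / 2 * integrating_factor \<gamma> 0 * integral {0..T} (forcing \<gamma>))"
    using guided_ode_first_integral[OF _ assms] by blast
qed (use guided_ode_first_integral[OF _ assms] in blast)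

section \<open>Gaussian laws and their images under the affine flow\<close>

lemma prob_space_gaussian: "v > 0 \<Longrightarrow> prob_space (gaussian m v)"
  unfolding gaussian_def by (intro prob_space_normal_density) simp

lemma distributed_gaussian: "distributed (gaussian m v) lborel (\<lambda>x. x) (normal_density m (sqrt v))"
  by (auto simp: distributed_def gaussian_def distr_id2)

lemma gaussian_expectation: "v > 0 \<Longrightarrow> prob_space.expectation (gaussian m v) (\<lambda>x. x) = m"
  using prob_space.normal_distributed_expectation[OF prob_space_gaussian _ distributed_gaussian]
  by simp

lemma gaussian_variance: "v > 0 \<Longrightarrow> prob_space.variance (gaussian m v) (\<lambda>x. x) = v"
  using prob_space.normal_distributed_variance[OF prob_space_gaussian _ distributed_gaussian]
  by simp

lemma distr_gaussian_affine:
  assumes "v > 0" "\<alpha> > 0"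
  shows "distr (gaussian m v) borel (\<lambda>x. \<beta> + \<alpha> * x) = gaussian (\<beta> + \<alpha> * m) (\<alpha>\<^sup>2 * v)"
proof -
  interpret prob_space "gaussian m v"
    by (rule prob_space_gaussian) fact
  have "distributed (gaussian m v) lborel (\<lambda>x. \<beta> + \<alpha> * x) (normal_density (\<beta> + \<alpha> * m) (\<bar>\<alpha>\<bar> * sqrt v))"
    using assms by (intro normal_density_affine distributed_gaussian) auto
  then have "distr (gaussian m v) lborel (\<lambda>x. \<beta> + \<alpha> * x) = gaussian (\<beta> + \<alpha> * m) (\<alpha>\<^sup>2 * v)"
    using assms by (simp add: distributed_def gaussian_def real_sqrt_mult)
  then show ?thesis
    \<comment> \<open>\<open>borel\<close> and \<open>lborel\<close> have the same measurable sets,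
      and \<open>distr\<close> uses nothing else of its target.\<close>
    by (simp cong: distr_cong)
qed

text \<open>The right-hand side is the squared slope of the flow times the variance
  \<open>1 + T\<close> of the law at time \<open>T\<close>.\<close>

lemma psi_eq:
  "2 powr (1 - \<gamma>) * psi \<gamma> T = (integrating_factor \<gamma> 0 / integrating_factor \<gamma> T)\<^sup>2 * (1 + T)"
proof -
  have sq: "(y powr (a / 2))\<^sup>2 = y powr a" for y a :: real
    by (simp add: power2_eq_square powr_add[symmetric])
  show ?thesis
    by (simp add: psi_def integrating_factor_0 integrating_factor_def power_divide power_mult_distrib sq)
qed

lemma q0_deter_eq:
  assumes "T \<ge> 0"
  shows "q0_deter \<gamma> c T = gaussian (c * phi \<gamma> T) (2 powr (1 - \<gamma>) * psi \<gamma> T)"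
proof -
  let ?\<alpha> = "integrating_factor \<gamma> 0 / integrating_factor \<gamma> T"
  let ?\<beta> = "c * (\<gamma> / 2 * integrating_factor \<gamma> 0 * integral {0..T} (forcing \<gamma>))"
  have "q0_deter \<gamma> c T = distr (gaussian c (1 + T)) borel (\<lambda>y. ?\<beta> + ?\<alpha> * y)"
    by (simp only: q0_deter_def gaussian_def cond_density_def backward_flow_eq[OF assms, abs_def] add.commute)
  also have "\<dots> = gaussian (?\<beta> + ?\<alpha> * c) (?\<alpha>\<^sup>2 * (1 + T))"
    using assms integrating_factor_pos[of _ \<gamma>] by (intro distr_gaussian_affine) auto
  also have "?\<beta> + ?\<alpha> * c = c * phi \<gamma> T"
    by (simp add: phi_eq algebra_simps)
  finally show ?thesis
    using psi_eq by simp
qed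

subsection \<open>The limit of the mean factor\<close>

text \<open>The moment of order \<open>a\<close> of \<open>(1 + w\<^sup>2) / 2\<close> for
  \<open>w\<close> uniform on \<open>[0, 1]\<close>, written \<open>F a\<close> in the
  introduction.\<close>

definition half_quadratic_moment :: "real \<Rightarrow> real" where
  "half_quadratic_moment a = integral {0..1} (\<lambda>w. ((1 + w\<^sup>2) / 2) powr a)"

lemma continuous_on_half_quadratic_powr:
  "continuous_on S (\<lambda>w::real. ((1 + w\<^sup>2) / 2) powr a)"
proof -
  have "1 + w\<^sup>2 \<noteq> 0" for w :: real
    using zero_le_power2[of w] by linarith
  then show ?thesis
    by (intro continuous_intros) auto
qed

lemma half_quadratic_powr_integral:
  "((\<lambda>w. ((1 + w\<^sup>2) / 2) powr a) has_integral half_quadratic_moment a) {0..1}"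
  unfolding half_quadratic_moment_def
  by (intro integrable_integral integrable_continuous_interval continuous_on_half_quadratic_powr)

text \<open>Substitute \<open>w = (s + 1) powr (- 1 / 2)\<close>, so that \<open>(s + 2) / (s + 1) = 1 + w\<^sup>2\<close>.\<close>

lemma integral_forcing_eq:
  fixes \<gamma> T :: real
  assumes "T \<ge> 0"
  defines "H \<equiv> \<lambda>x. integral {0..x} (\<lambda>w. ((1 + w\<^sup>2) / 2) powr ((\<gamma> - 1) / 2))"
  shows "1 / 2 * integrating_factor \<gamma> 0 * integral {0..T} (forcing \<gamma>) = H 1 - H ((T + 1) powr (- 1 / 2))"
proof -
  let ?f = "\<lambda>w::real. ((1 + w\<^sup>2) / 2) powr ((\<gamma> - 1) / 2)"
  let ?w = "\<lambda>s::real. (s + 1) powr (- 1 / 2)"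
  \<comment> \<open>The antiderivative carries a minus sign because \<open>?w\<close> decreases from
    \<open>1\<close>.\<close>
  have "((\<lambda>s. 1 / 2 * integrating_factor \<gamma> 0 * forcing \<gamma> s) has_integral
          (- H (?w T) - - H (?w 0))) {0..T}"
  proof (rule fundamental_theorem_of_calculus[OF \<open>T \<ge> 0\<close>])
    fix s assume s: "s \<in> {0..T}"
    have w01: "?w u \<in> {0..1}" if "u \<ge> 0" for u
      using that powr_mono2'[of "- 1 / 2" 1 "u + 1"] by simp
    have w2: "(?w s)\<^sup>2 = 1 / (s + 1)"
      using s by (simp add: power2_eq_square powr_add[symmetric] powr_minus_divide)
    \<comment> \<open>\<open>H\<close> is differentiated only within \<open>{0..1}\<close>; the
      image of \<open>{0..T}\<close> under \<open>?w\<close> lies there, which suits the chain rule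
      on images.\<close>
    have dH: "(H has_real_derivative ?f (?w s)) (at (?w s) within ?w ` {0..T})"
      unfolding H_def
      by (rule has_field_derivative_subset[OF integral_has_real_derivative[
            where a = 0 and b = 1, OF continuous_on_half_quadratic_powr]])
         (use w01 s in auto)
    have dw: "(?w has_real_derivative (- 1 / 2) * (s + 1) powr (- 3 / 2)) (at s within {0..T})"
      using s by (auto intro!: derivative_eq_intros)
    have "(1 + (?w s)\<^sup>2) / 2 = (s + 2) / (s + 1) / 2"
      using s unfolding w2 by (simp add: field_simps)
    then have "?f (?w s) = (s + 2) powr ((\<gamma> - 1) / 2) / (s + 1) powr ((\<gamma> - 1) / 2) / 2 powr ((\<gamma> - 1) / 2)"
      using s by (simp only: powr_divide)
    moreover have "(s + 2) powr ((\<gamma> - 1) / 2) = 1 / (s + 2) powr ((1 - \<gamma>) / 2)"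
      using powr_minus_divide[of "s + 2" "(1 - \<gamma>) / 2"] by (simp add: minus_divide_left)
    moreover have "(2::real) powr ((1 - \<gamma>) / 2) = 1 / 2 powr ((\<gamma> - 1) / 2)"
      using powr_minus_divide[of 2 "(\<gamma> - 1) / 2"] by (simp add: minus_divide_left)
    \<comment> \<open>The part \<open>- 3 / 2\<close> comes from the derivative of
      \<open>?w\<close>, the rest from the denominator of \<open>(s + 2) / (s + 1)\<close>.\<close>
    moreover have e: "- ((\<gamma> + 2) / 2) = - 3 / 2 - (\<gamma> - 1) / 2"
      by (simp add: field_simps)
    have "(s + 1) powr (- ((\<gamma> + 2) / 2)) = (s + 1) powr (- 3 / 2) / (s + 1) powr ((\<gamma> - 1) / 2)"
      unfolding e powr_diff ..
    ultimately have "- (?f (?w s) * ((- 1 / 2) * (s + 1) powr (- 3 / 2)))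
        = 1 / 2 * integrating_factor \<gamma> 0 * forcing \<gamma> s"
      by (simp add: integrating_factor_0 forcing_def)
    with DERIV_minus[OF DERIV_image_chain[OF dH dw]]
    show "((\<lambda>s. - H (?w s)) has_vector_derivative 1 / 2 * integrating_factor \<gamma> 0 * forcing \<gamma> s)
            (at s within {0..T})"
      by (simp add: has_real_derivative_iff_has_vector_derivative[symmetric] o_def)
  qed
  then show ?thesis
    by (auto dest!: integral_unique)
qed

lemma phi_tendsto: "(phi \<gamma> \<longlongrightarrow> \<gamma> * half_quadratic_moment ((\<gamma> - 1) / 2)) at_top"
proof -
  let ?f = "\<lambda>w::real. ((1 + w\<^sup>2) / 2) powr ((\<gamma> - 1) / 2)"
  define H where "H = (\<lambda>x. integral {0..x} ?f)"
  let ?w = "\<lambda>T::real. (T + 1) powr (- 1 / 2)"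
  have w_lim: "(?w \<longlongrightarrow> 0) at_top"
    by real_asymp
  have "continuous_on {0..1} H"
    unfolding H_def
    by (intro indefinite_integral_continuous_1 integrable_continuous_interval continuous_on_half_quadratic_powr)
  moreover have "\<forall>\<^sub>F T in at_top. ?w T \<in> {0..1}"
    using eventually_ge_at_top[of 0]
  proof eventually_elim
    case (elim T)
    then show ?case
      using powr_mono2'[of "- 1 / 2" 1 "T + 1"] by simp
  qed
  ultimately have "((\<lambda>T. H (?w T)) \<longlongrightarrow> H 0) at_top"
    by (intro continuous_on_tendsto_compose[OF _ w_lim]) auto
  then have H_lim: "((\<lambda>T. H (?w T)) \<longlongrightarrow> 0) at_top"
    by (simp add: H_def)
  \<comment> \<open>The two exponents in \<open>integrating_factor\<close> add up to
    \<open>1 / 2\<close>, so it grows like \<open>sqrt T\<close> for every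
    \<open>\<gamma>\<close>.\<close>
  have "((\<lambda>T. integrating_factor \<gamma> 0 / integrating_factor \<gamma> T) \<longlongrightarrow> 0) at_top"
    unfolding integrating_factor_def[abs_def] by real_asymp
  then have "((\<lambda>T. integrating_factor \<gamma> 0 / integrating_factor \<gamma> T + \<gamma> * (H 1 - H (?w T)))
      \<longlongrightarrow> 0 + \<gamma> * (H 1 - 0)) at_top"
    by (intro tendsto_intros H_lim)
  moreover have "\<forall>\<^sub>F T in at_top. integrating_factor \<gamma> 0 / integrating_factor \<gamma> T + \<gamma> * (H 1 - H (?w T)) = phi \<gamma> T"
    using eventually_ge_at_top[of 0]
  proof eventually_elim
    case (elim T)
    show ?case
      unfolding phi_eq H_def integral_forcing_eq[OF elim, symmetric] by simp
  qed
  ultimately show ?thesis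
    by (auto simp: H_def half_quadratic_moment_def intro: Lim_transform_eventually)
qed

lemma phi_lim_eq: "phi_lim \<gamma> = \<gamma> * half_quadratic_moment ((\<gamma> - 1) / 2)"
  unfolding phi_lim_def by (rule tendsto_Lim[OF _ phi_tendsto]) simp

section \<open>Recursion and lower bounds for the moments\<close>

lemma half_quadratic_moment_0: "half_quadratic_moment 0 = 1"
proof -
  \<comment> \<open>Since \<open>0 powr 0 = 0\<close>, a nonzero base is required for
    \<open>powr 0\<close> to give 1.\<close>
  have "1 + w\<^sup>2 \<noteq> 0" for w :: real
    using zero_le_power2[of w] by linarith
  then show ?thesis
    by (simp add: half_quadratic_moment_def)
qed

text \<open>Integrate the derivative of \<open>w * u powr a\<close>, where \<open>u = (1 + w\<^sup>2) / 2\<close> and \<open>w\<^sup>2 = 2 * u - 1\<close>.\<close>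

lemma half_quadratic_moment_rec:
  "(2 * a + 1) * half_quadratic_moment a = 1 + a * half_quadratic_moment (a - 1)"
proof -
  let ?u = "\<lambda>w::real. (1 + w\<^sup>2) / 2"
  have 1: "((\<lambda>w. (2 * a + 1) * ?u w powr a - a * ?u w powr (a - 1)) has_integral
          (1 * ?u 1 powr a - 0 * ?u 0 powr a)) {0..1}"
  proof (rule fundamental_theorem_of_calculus)
    fix w :: real
    have u0: "?u w > 0"
      using zero_le_power2[of w] by (simp add: add_pos_nonneg)
    have "((\<lambda>w. w * ?u w powr a) has_real_derivative
            1 * ?u w powr a + (a * ?u w powr (a - 1) * w) * w) (at w within {0..1})"
      using u0 by (intro DERIV_mult) (auto intro!: derivative_eq_intros simp: powr_diff)
    moreover have "?u w powr a = ?u w * ?u w powr (a - 1)"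
      using u0 by (simp add: powr_diff)
    then have "1 * ?u w powr a + (a * ?u w powr (a - 1) * w) * w
        = (2 * a + 1) * ?u w powr a - a * ?u w powr (a - 1)"
      by (simp add: power2_eq_square algebra_simps)
    ultimately show "((\<lambda>w. w * ?u w powr a) has_vector_derivative
        (2 * a + 1) * ?u w powr a - a * ?u w powr (a - 1)) (at w within {0..1})"
      by (simp add: has_real_derivative_iff_has_vector_derivative)
  qed simp
  have 2: "((\<lambda>w. (2 * a + 1) * ?u w powr a - a * ?u w powr (a - 1)) has_integral
      ((2 * a + 1) * half_quadratic_moment a - a * half_quadratic_moment (a - 1))) {0..1}"
    by (intro has_integral_diff has_integral_mult_right half_quadratic_powr_integral)
  show ?thesis
    using has_integral_unique[OF 1 2] by simp
qed

text \<open>Compare with the integral of \<open>w powr b\<close>. At \<open>b = a - 1\<close> this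
  makes the term \<open>a * F (a - 1)\<close> of the recursion at least 1.\<close>

lemma half_quadratic_moment_ge_inverse:
  assumes "b > 0"
  shows "1 / (b + 1) \<le> half_quadratic_moment b"
proof (rule has_integral_le[OF _ half_quadratic_powr_integral])
  show "((\<lambda>w::real. w powr b) has_integral 1 / (b + 1)) {0..1}"
    using has_integral_powr_from_0[of b 1] assms by simp
  fix w :: real assume "w \<in> {0..1}"
  moreover have "w \<le> (1 + w\<^sup>2) / 2"
    using zero_le_power2[of "w - 1"] by (simp add: power2_eq_square algebra_simps)
  ultimately show "w powr b \<le> ((1 + w\<^sup>2) / 2) powr b"
    using assms by (intro powr_mono2) auto
qed

text \<open>Bernoulli's inequality for nonpositive exponents, from \<open>ln x \<le> x - 1\<close>
  and \<open>1 + y \<le> exp y\<close>.\<close>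

lemma powr_ge_tangent:
  fixes x p :: real
  assumes "x > 0" "p \<le> 0"
  shows "1 + p * (x - 1) \<le> x powr p"
proof -
  have "p * (x - 1) \<le> p * ln x"
    using assms by (intro mult_left_mono_neg ln_le_minus_one) auto
  also have "1 + p * ln x \<le> x powr p"
    using assms exp_ge_add_one_self[of "p * ln x"] by (simp add: powr_def)
  finally show ?thesis
    by simp
qed

text \<open>
  Jensen's inequality for the convex function \<open>x powr (a - 1)\<close> and the weight \<open>u = (1 + w\<^sup>2) / 2\<close>,
  under which \<open>u\<close> itself has mean \<open>(7/15) / (2/3) = 7/10\<close>.
\<close>

lemma half_quadratic_moment_ge_Jensen:
  assumes "a \<le> 1"
  shows "2 / 3 * (7 / 10) powr (a - 1) \<le> half_quadratic_moment a"
proof (rule has_integral_le[OF _ half_quadratic_powr_integral])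
  let ?u = "\<lambda>w::real. (1 + w\<^sup>2) / 2"
  \<comment> \<open>\<open>?u\<close> times the tangent of \<open>x powr (a - 1)\<close> at
    \<open>7 / 10\<close>, a polynomial in \<open>w\<close> with antiderivative
    \<open>G\<close>.\<close>
  let ?g = "\<lambda>w::real. (7 / 10) powr (a - 1) * (?u w * (1 + (a - 1) * (?u w / (7 / 10) - 1)))"
  define G where "G = (\<lambda>w::real. (7 / 10) powr (a - 1) *
    ((2 - a) * (w / 2 + w ^ 3 / 6) + (a - 1) * (10 / 7) * (w / 4 + w ^ 3 / 6 + w ^ 5 / 20)))"
  have "(?g has_integral (G 1 - G 0)) {0..1}"
  proof (rule fundamental_theorem_of_calculus)
    fix w :: real
    have "(G has_real_derivative (7 / 10) powr (a - 1) * ((2 - a) * ?u w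
        + (a - 1) * (10 / 7) * (1 / 4 + w ^ 2 / 2 + w ^ 4 / 4))) (at w within {0..1})"
      unfolding G_def
      by (intro DERIV_cmult DERIV_add) (auto intro!: derivative_eq_intros simp: add_divide_distrib)
    moreover have "v * (1 + (a - 1) * (v / (7 / 10) - 1)) = (2 - a) * v + (a - 1) * (10 / 7) * v\<^sup>2" for v
      by (simp add: field_simps power2_eq_square)
    moreover have "(?u w)\<^sup>2 = 1 / 4 + w ^ 2 / 2 + w ^ 4 / 4"
      by (simp add: field_simps power2_sum)
    ultimately have "(G has_real_derivative ?g w) (at w within {0..1})"
      by (simp only:)
    then show "(G has_vector_derivative ?g w) (at w within {0..1})"
      by (simp add: has_real_derivative_iff_has_vector_derivative)
  qed simp
  \<comment> \<open>The integrals of \<open>?u\<close> and its square are \<open>2 / 3\<close> and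
    \<open>7 / 15\<close>; as \<open>10 / 7 * (7 / 15) = 2 / 3\<close>, the linear part of the
    tangent integrates to 0.\<close>
  moreover have "G 1 - G 0 = 2 / 3 * (7 / 10) powr (a - 1)"
    by (simp add: G_def field_simps)
  ultimately show "(?g has_integral 2 / 3 * (7 / 10) powr (a - 1)) {0..1}"
    by simp
  fix w :: real
  have u0: "?u w > 0"
    using zero_le_power2[of w] by (simp add: add_pos_nonneg)
  have "1 + (a - 1) * (?u w / (7 / 10) - 1) \<le> (?u w / (7 / 10)) powr (a - 1)"
    using u0 assms by (intro powr_ge_tangent) auto
  then have "?g w \<le> (7 / 10) powr (a - 1) * (?u w * (?u w / (7 / 10)) powr (a - 1))"
    using u0 by (intro mult_left_mono) auto
  also have "\<dots> = ?u w * ?u w powr (a - 1)"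
    using u0 powr_divide[of "?u w" "7 / 10" "a - 1"] by simp
  also have "\<dots> = ?u w powr a"
    using u0 by (simp add: powr_diff)
  finally show "?g w \<le> ?u w powr a" .
qed

section \<open>Values and bounds of the limiting mean factor\<close>

text \<open>Here \<open>a = 1\<close>, and the recursion reads
  \<open>3 * F 1 = 1 + F 0 = 2\<close>.\<close>

lemma phi_lim_3: "phi_lim 3 = 2"
  using half_quadratic_moment_rec[of 1] by (simp add: phi_lim_eq half_quadratic_moment_0)

lemma phi_lim_ge:
  assumes "1 \<le> \<gamma>" "\<gamma> \<le> 3"
  shows "\<gamma> * (7/15) * (10/7) powr ((5 - \<gamma>) / 2) \<le> phi_lim \<gamma>"
proof -
  let ?a = "(\<gamma> - 1) / 2"
  have "(10/7 :: real) powr ((5 - \<gamma>) / 2) = (7/10) powr (?a - 1 - 1)"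
    by (simp add: powr_def ln_div field_simps)
  also have "\<dots> = (7/10) powr (?a - 1) / (7/10)"
    using powr_diff[of "7/10" "?a - 1" 1] by simp
  \<comment> \<open>The constants combine as \<open>7/15 / (7/10) = 2/3\<close>.\<close>
  finally have "7/15 * (10/7) powr ((5 - \<gamma>) / 2) = 2/3 * (7/10) powr (?a - 1)"
    by simp
  also have "\<dots> \<le> half_quadratic_moment ?a"
    using assms by (intro half_quadratic_moment_ge_Jensen) auto
  finally have "\<gamma> * (7/15 * (10/7) powr ((5 - \<gamma>) / 2)) \<le> \<gamma> * half_quadratic_moment ?a"
    using assms by (intro mult_left_mono) auto
  then show ?thesis
    by (simp add: phi_lim_eq mult.assoc)
qed

lemma phi_lim_ge_2:
  assumes "\<gamma> > 3"
  shows "2 \<le> phi_lim \<gamma>"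
proof -
  let ?a = "(\<gamma> - 1) / 2"
  have "1 / ?a \<le> half_quadratic_moment (?a - 1)"
    using half_quadratic_moment_ge_inverse[of "?a - 1"] assms by simp
  then have "1 \<le> ?a * half_quadratic_moment (?a - 1)"
    using assms by (simp add: field_simps)
  \<comment> \<open>Hence the left side of the recursion at \<open>?a\<close> is
    \<open>phi_lim \<gamma>\<close> itself.\<close>
  moreover have e: "2 * ?a + 1 = \<gamma>"
    by (simp add: field_simps)
  ultimately show ?thesis
    using half_quadratic_moment_rec[of ?a, unfolded e] by (simp add: phi_lim_eq)
qed

section \<open>Convergence of mean and variance\<close>

lemma psi_tendsto: "(psi \<gamma> \<longlongrightarrow> 1) at_top"
  unfolding psi_def[abs_def] by real_asymp

lemma moments_tendsto:
  shows "((\<lambda>T. prob_space.expectation (q0_deter \<gamma> c T) (\<lambda>x. x)) \<longlongrightarrow> c * phi_lim \<gamma>) at_top"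
    and "((\<lambda>T. prob_space.variance (q0_deter \<gamma> c T) (\<lambda>x. x)) \<longlongrightarrow> 2 powr (1 - \<gamma>)) at_top"
proof -
  \<comment> \<open>The moment formulas for \<open>gaussian\<close> require positive
    variance.\<close>
  have *: "2 powr (1 - \<gamma>) * psi \<gamma> T > 0" if "T \<ge> 0" for T
    using that by (simp add: psi_def)
  have "((\<lambda>T. c * phi \<gamma> T) \<longlongrightarrow> c * phi_lim \<gamma>) at_top"
    unfolding phi_lim_eq by (intro tendsto_mult_left phi_tendsto)
  moreover have "\<forall>\<^sub>F T in at_top. c * phi \<gamma> T = prob_space.expectation (q0_deter \<gamma> c T) (\<lambda>x. x)"
    using eventually_ge_at_top[of 0]
    by eventually_elim (simp add: q0_deter_eq gaussian_expectation[OF *])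
  ultimately show "((\<lambda>T. prob_space.expectation (q0_deter \<gamma> c T) (\<lambda>x. x)) \<longlongrightarrow> c * phi_lim \<gamma>) at_top"
    by (rule Lim_transform_eventually)
  have "((\<lambda>T. 2 powr (1 - \<gamma>) * psi \<gamma> T) \<longlongrightarrow> 2 powr (1 - \<gamma>) * 1) at_top"
    by (intro tendsto_mult_left psi_tendsto)
  moreover have "\<forall>\<^sub>F T in at_top. 2 powr (1 - \<gamma>) * psi \<gamma> T = prob_space.variance (q0_deter \<gamma> c T) (\<lambda>x. x)"
    using eventually_ge_at_top[of 0]
    by eventually_elim (use gaussian_variance[OF *] in \<open>simp add: q0_deter_eq\<close>)
  ultimately show "((\<lambda>T. prob_space.variance (q0_deter \<gamma> c T) (\<lambda>x. x)) \<longlongrightarrow> 2 powr (1 - \<gamma>)) at_top"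
    by (simp add: Lim_transform_eventually)
qed

theorem theorem2:
  shows "(\<forall>(c::real) (T::real) (\<gamma>::real). T > 0 \<longrightarrow> \<gamma> > 1 \<longrightarrow>
            q0_deter \<gamma> c T = gaussian (c * phi \<gamma> T) (2 powr (1 - \<gamma>) * psi \<gamma> T))
       \<and> (\<forall>\<gamma>\<ge>1. (phi \<gamma> \<longlongrightarrow> phi_lim \<gamma>) at_top)
       \<and> (\<forall>\<gamma>\<in>{1..3}. phi_lim \<gamma> \<ge> \<gamma> * (7/15) * (10/7) powr ((5 - \<gamma>) / 2))
       \<and> phi_lim 1 = 1
       \<and> phi_lim 3 = 2
       \<and> (\<forall>\<gamma>>3. phi_lim \<gamma> \<ge> 2)
       \<and> (\<forall>(c::real) (\<gamma>::real). \<gamma> > 1 \<longrightarrow>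
            ((\<lambda>T. prob_space.expectation (q0_deter \<gamma> c T) (\<lambda>x. x)) \<longlongrightarrow> c * phi_lim \<gamma>) at_top
          \<and> ((\<lambda>T. prob_space.variance (q0_deter \<gamma> c T) (\<lambda>x. x)) \<longlongrightarrow> 2 powr (1 - \<gamma>)) at_top)"
  using q0_deter_eq phi_tendsto phi_lim_ge phi_lim_3 phi_lim_ge_2 moments_tendsto
  by (auto simp: phi_lim_eq[of 1] half_quadratic_moment_0 phi_lim_eq[symmetric])

end
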